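(* Let $a\ge 0$ be a real number, let $G$ be a connected graph of order $n$ with minimum degree $\delta\le\frac{n-1}{2}$, and let $\overline{G}$ be the complement of $G$. If $$\lambda_{1}(aD(\overline{G})+A(\overline{G}))<(a+1)\delta,$$ then $G$ has a fractional perfect matching.
   Context: Graphs are finite, simple and undirected. For a graph $H$, $A(H)$ is the adjacency matrix, $D(H)$ is the diagonal matrix of vertex degrees, and $\lambda_1(M)$ denotes the largest eigenvalue of a real symmetric matrix $M$. A fractional matching of $G$ is a function $f:E(G)\to[0,1]$ such that for every vertex $v$ the sum of $f(e)$ over all edges $e$ incident with $v$ is at most $1$. It is a fractional perfect matching if $\sum_{e\in E(G)}f(e)=n/2$. *)

theory Defs
  imports "HOL-Analysis.Analysis"
begin

text \<open>
  A finite simple graph has as vertex set all of a finite type \<open>'v\<close>, so its order is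
  \<open>CARD('v)\<close>, and it is given by its set of edges, which are two-element sets of vertices.
\<close>

definition simple_graph :: "('v::finite) set set \<Rightarrow> bool" where
  "simple_graph E \<longleftrightarrow> (\<forall>e\<in>E. card e = 2)"

definition connected_graph :: "('v::finite) set set \<Rightarrow> bool" where
  "connected_graph E \<longleftrightarrow> (\<forall>u v. (\<lambda>x y. {x, y} \<in> E)\<^sup>*\<^sup>* u v)"

definition complement_graph :: "('v::finite) set set \<Rightarrow> 'v set set" where
  "complement_graph E = {e. card e = 2 \<and> e \<notin> E}"

definition degree :: "('v::finite) set set \<Rightarrow> 'v \<Rightarrow> nat" where
  "degree E v = card {e \<in> E. v \<in> e}"

definition min_degree :: "('v::finite) set set \<Rightarrow> nat" where
  "min_degree E = Min (range (degree E))"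

text \<open>In a simple graph \<open>{u, u}\<close> is never an edge, so the diagonal below is zero.\<close>

definition adjacency_matrix :: "('v::finite) set set \<Rightarrow> real^'v^'v" where
  "adjacency_matrix E = (\<chi> u v. if {u, v} \<in> E then 1 else 0)"

definition degree_matrix :: "('v::finite) set set \<Rightarrow> real^'v^'v" where
  "degree_matrix E = (\<chi> u v. if u = v then real (degree E u) else 0)"

definition eigenvalue :: "real^'n^'n \<Rightarrow> real \<Rightarrow> bool" where
  "eigenvalue M k \<longleftrightarrow> (\<exists>x. x \<noteq> 0 \<and> M *v x = k *\<^sub>R x)"

text \<open>
  Meant for symmetric matrices only: these have a finite nonempty set of real eigenvalues, so
  that \<open>Max\<close> really is a maximum.
\<close>

definition largest_eigenvalue :: "real^'n^'n \<Rightarrow> real" where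
  "largest_eigenvalue M = Max {k. eigenvalue M k}"

text \<open>A weighting is a function on all sets of vertices; only its values on edges matter.\<close>

definition fractional_matching :: "('v::finite) set set \<Rightarrow> ('v set \<Rightarrow> real) \<Rightarrow> bool" where
  "fractional_matching E f \<longleftrightarrow>
     (\<forall>e\<in>E. 0 \<le> f e \<and> f e \<le> 1) \<and> (\<forall>v. (\<Sum>e | e \<in> E \<and> v \<in> e. f e) \<le> 1)"

definition fractional_perfect_matching :: "('v::finite) set set \<Rightarrow> ('v set \<Rightarrow> real) \<Rightarrow> bool" where
  "fractional_perfect_matching E f \<longleftrightarrow>
     fractional_matching E f \<and> (\<Sum>e\<in>E. f e) = real CARD('v) / 2"

end

theory Submission
  imports Defs
begin

text \<open>
  Apply Hall's theorem to the open neighbourhoods. If they have distinct representatives, these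
  form a permutation \<open>s\<close> with every \<open>v\<close> adjacent to \<open>s v\<close>, and giving each \<open>{v, s v}\<close> weight \<open>1/2\<close>
  yields a fractional perfect matching. Otherwise some \<open>X\<close> has \<open>\<bar>N(X)\<bar> < \<bar>X\<bar>\<close>, and \<open>I = X - N(X)\<close> is
  an independent set with \<open>\<bar>I\<bar> > \<bar>N(I)\<bar> \<ge> \<delta>\<close>. It is a clique of the complement, so the Rayleigh
  quotient of its indicator vector is at least \<open>(a + 1)(\<bar>I\<bar> - 1) \<ge> (a + 1)\<delta>\<close>.
\<close>

section \<open>Rayleigh quotients of real symmetric matrices\<close>

lemma inner_matrix_vector_symmetric:
  fixes M :: "real^'n^'n"
  assumes "transpose M = M"
  shows "(M *v x) \<bullet> y = x \<bullet> (M *v y)"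
  using dot_lmul_matrix[of x M y] transpose_matrix_vector[of M x] assms by simp

text \<open>Eigenvectors for distinct eigenvalues are orthogonal, and a pairwise orthogonal set in a
  Euclidean space is finite. This makes the \<open>Max\<close> in \<open>largest_eigenvalue\<close>
  an upper bound for every eigenvalue.\<close>

lemma finite_eigenvalues_symmetric:
  fixes M :: "real^'n^'n"
  assumes sym: "transpose M = M"
  shows "finite {k. eigenvalue M k}"
proof -
  define w where "w k = (SOME x. x \<noteq> 0 \<and> M *v x = k *\<^sub>R x)" for k
  have w: "w k \<noteq> 0 \<and> M *v w k = k *\<^sub>R w k" if "eigenvalue M k" for k
    using someI_ex[OF that[unfolded eigenvalue_def]] unfolding w_def .
  have orth: "orthogonal (w k) (w l)" if "eigenvalue M k" "eigenvalue M l" "k \<noteq> l" for k l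
  proof -
    have "k * (w k \<bullet> w l) = (M *v w k) \<bullet> w l" using w[OF that(1)] by simp
    also have "\<dots> = w k \<bullet> (M *v w l)"
      by (rule inner_matrix_vector_symmetric[OF sym])
    also have "\<dots> = l * (w k \<bullet> w l)" using w[OF that(2)] by simp
    finally show ?thesis using that(3) by (simp add: orthogonal_def)
  qed
  have inj: "inj_on w {k. eigenvalue M k}"
    by (rule inj_onI) (metis mem_Collect_eq orth orthogonal_self w)
  have "pairwise orthogonal (w ` {k. eigenvalue M k})"
    by (auto simp: pairwise_def intro!: orth)
  then have "finite (w ` {k. eigenvalue M k})"
    by (rule pairwise_orthogonal_imp_finite)
  then show ?thesis using inj by (rule finite_imageD)
qed

text \<open>Moving from \<open>x\<close> to \<open>x - t *\<^sub>R (Q *v x)\<close> changes the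
  quadratic form to first order by \<open>-2 * t\<close> times the squared norm of
  \<open>Q *v x\<close>. If that norm were nonzero, the form would be negative for small positive
  \<open>t\<close>.\<close>

lemma psd_isotropic_in_kernel:
  fixes Q :: "real^'n^'n"
  assumes sym: "transpose Q = Q"
    and psd: "\<And>y. 0 \<le> y \<bullet> (Q *v y)"
    and x: "x \<bullet> (Q *v x) = 0"
  shows "Q *v x = 0"
proof (rule ccontr)
  assume nz: "Q *v x \<noteq> 0"
  define z where "z = Q *v x"
  define c where "c = z \<bullet> (Q *v z)"
  have zz: "z \<bullet> z > 0" using nz by (simp add: z_def)
  have c0: "0 \<le> c" using psd by (simp add: c_def)
  have xz: "x \<bullet> (Q *v z) = z \<bullet> z"
    using inner_matrix_vector_symmetric[OF sym, of x z] by (simp add: z_def)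
  have *: "0 \<le> - 2 * t * (z \<bullet> z) + t\<^sup>2 * c" for t
  proof -
    have "(x - t *\<^sub>R z) \<bullet> (Q *v (x - t *\<^sub>R z)) = - 2 * t * (z \<bullet> z) + t\<^sup>2 * c"
      using x xz unfolding c_def
      by (simp add: matrix_vector_mult_diff_distrib matrix_vector_mult_scaleR inner_diff_left
          inner_diff_right right_diff_distrib z_def[symmetric] power2_eq_square)
    then show ?thesis using psd[of "x - t *\<^sub>R z"] by simp
  qed
  \<comment> \<open>With this \<open>t\<close> the quadratic term cancels at most half of the linear
    one. The denominator \<open>c + 1\<close> also covers \<open>c = 0\<close>.\<close>
  define t where "t = (z \<bullet> z) / (c + 1)"
  have t: "t > 0" using zz c0 by (simp add: t_def)
  have "t * c \<le> z \<bullet> z" using c0 zz by (simp add: t_def field_simps)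
  then have "t * (t * c) \<le> t * (z \<bullet> z)" using t by (intro mult_left_mono) auto
  moreover have "t * (z \<bullet> z) > 0" using t zz by simp
  ultimately show False using *[of t] by (simp add: power2_eq_square)
qed

text \<open>By compactness the form attains its maximum \<open>k\<close> on the unit sphere. It
  remains to see that \<open>k\<close> is itself an eigenvalue.\<close>

lemma rayleigh_le_largest_eigenvalue:
  fixes M :: "real^'n^'n"
  assumes sym: "transpose M = M"
  shows "y \<bullet> (M *v y) \<le> largest_eigenvalue M * (y \<bullet> y)"
proof -
  let ?S = "sphere (0::real^'n) 1"
  have "?S \<noteq> {}" by simp
  moreover have "continuous_on ?S (\<lambda>x. x \<bullet> (M *v x))"
    by (intro continuous_intros matrix_vector_mult_linear_continuous_on)
  ultimately have "\<exists>x\<in>?S. \<forall>z\<in>?S. z \<bullet> (M *v z) \<le> x \<bullet> (M *v x)"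
    by (intro continuous_attains_sup compact_sphere)
  then obtain x where x: "x \<in> ?S"
    and max: "\<And>z. z \<in> ?S \<Longrightarrow> z \<bullet> (M *v z) \<le> x \<bullet> (M *v x)"
    by blast
  define k where "k = x \<bullet> (M *v x)"
  have bound: "z \<bullet> (M *v z) \<le> k * (z \<bullet> z)" for z
  proof (cases "z = 0")
    case False
    have "(z /\<^sub>R norm z) \<bullet> (M *v (z /\<^sub>R norm z)) \<le> k"
      unfolding k_def by (rule max) (use False in simp)
    then have "(z \<bullet> (M *v z)) / (norm z)\<^sup>2 \<le> k"
      by (simp add: matrix_vector_mult_scaleR power2_eq_square divide_simps)
    then show ?thesis using False
      by (simp add: power2_norm_eq_inner[symmetric] pos_divide_le_eq)
  qed simp
  \<comment> \<open>Maximality of \<open>k\<close> makes \<open>Q\<close> positive semidefinite with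
    the maximiser \<open>x\<close> isotropic, so \<open>x\<close> lies in the kernel of
    \<open>Q\<close> and is an eigenvector of \<open>M\<close> for \<open>k\<close>.\<close>
  define Q where "Q = k *\<^sub>R mat 1 - M"
  have Qv: "Q *v z = k *\<^sub>R z - M *v z" for z
    by (simp add: Q_def matrix_vector_mult_diff_rdistrib scaleR_matrix_vector_assoc[symmetric])
  have "transpose Q = Q"
    using sym by (simp add: Q_def vec_eq_iff transpose_def mat_def)
  moreover have "0 \<le> z \<bullet> (Q *v z)" for z
    using bound[of z] by (simp add: Qv inner_diff_right)
  moreover have "x \<bullet> (Q *v x) = 0"
    using x by (simp add: Qv inner_diff_right k_def flip: power2_norm_eq_inner)
  ultimately have "Q *v x = 0" by (rule psd_isotropic_in_kernel)
  moreover have "x \<noteq> 0" using x by auto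
  ultimately have "eigenvalue M k" unfolding eigenvalue_def Qv by auto
  then have "k \<le> largest_eigenvalue M"
    unfolding largest_eigenvalue_def
    by (intro Max_ge finite_eigenvalues_symmetric[OF sym]) simp
  then have "k * (y \<bullet> y) \<le> largest_eigenvalue M * (y \<bullet> y)"
    by (intro mult_right_mono) auto
  then show ?thesis using bound[of y] by linarith
qed

section \<open>Cliques and the largest eigenvalue\<close>

lemma degree_eq_card_neighbours:
  assumes "simple_graph E"
  shows "degree E v = card {u. {v, u} \<in> E}"
proof -
  have "{e \<in> E. v \<in> e} = (\<lambda>u. {v, u}) ` {u. {v, u} \<in> E}"
  proof (intro equalityI subsetI)
    fix e assume e: "e \<in> {e \<in> E. v \<in> e}"
    then have "card e = 2" using assms by (auto simp: simple_graph_def)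
    then obtain u where "e = {v, u}" using e by (auto simp: card_2_iff)
    then show "e \<in> (\<lambda>u. {v, u}) ` {u. {v, u} \<in> E}" using e by auto
  qed auto
  moreover have "inj_on (\<lambda>u. {v, u}) {u. {v, u} \<in> E}"
    by (auto simp: inj_on_def doubleton_eq_iff)
  ultimately show ?thesis unfolding degree_def by (simp add: card_image)
qed

lemma clique_bound_largest_eigenvalue:
  fixes F :: "('v::finite) set set"
  assumes F: "simple_graph F" and a: "a \<ge> 0"
    and clique: "\<And>u v. u \<in> K \<Longrightarrow> v \<in> K \<Longrightarrow> u \<noteq> v \<Longrightarrow> {u, v} \<in> F"
    and "K \<noteq> {}"
  shows "(a + 1) * (real (card K) - 1) \<le> largest_eigenvalue (a *\<^sub>R degree_matrix F + adjacency_matrix F)"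
proof -
  define M where "M = a *\<^sub>R degree_matrix F + adjacency_matrix F"
  define x :: "real^'v" where "x = (\<chi> v. if v \<in> K then 1 else 0)"
  have K: "real (card K) > 0" using \<open>K \<noteq> {}\<close> by (simp add: card_gt_0_iff)
  have loop: "{u, u} \<notin> F" for u using F by (auto simp: simple_graph_def)
  have "transpose M = M"
    by (auto simp: M_def vec_eq_iff transpose_def degree_matrix_def adjacency_matrix_def insert_commute)
  note rayleigh = rayleigh_le_largest_eigenvalue[OF this, of x]
  have ind: "(\<Sum>u\<in>UNIV. x $ u * g u) = (\<Sum>u\<in>K. g u)" for g
    by (rule sum.mono_neutral_cong_right) (auto simp: x_def)
  have xx: "x \<bullet> x = card K"
    using ind[of "\<lambda>u. x $ u"] by (simp add: inner_vec_def x_def)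
  \<comment> \<open>In a row of the clique the diagonal contributes \<open>a\<close> times a degree
    that is at least \<open>card K - 1\<close>, and the adjacency entries contribute exactly
    \<open>card K - 1\<close>.\<close>
  have row: "(a + 1) * (real (card K) - 1) \<le> (M *v x) $ u" if u: "u \<in> K" for u
  proof -
    have card: "real (card (K - {u})) = real (card K) - 1"
      using u K by (simp add: card_Diff_singleton)
    have "K - {u} \<subseteq> {v. {u, v} \<in> F}" using clique u by auto
    then have "card (K - {u}) \<le> degree F u"
      by (simp add: degree_eq_card_neighbours[OF F] card_mono)
    then have deg: "real (card K) - 1 \<le> degree F u" using card by linarith
    have "(M *v x) $ u = (\<Sum>v\<in>K. M $ u $ v)"
      using ind[of "\<lambda>v. M $ u $ v"] by (simp add: matrix_vector_mult_def mult.commute)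
    also have "\<dots> = M $ u $ u + (\<Sum>v\<in>K - {u}. M $ u $ v)"
      using u by (simp add: sum.remove)
    also have "M $ u $ u = a * degree F u"
      using loop by (simp add: M_def degree_matrix_def adjacency_matrix_def)
    also have "(\<Sum>v\<in>K - {u}. M $ u $ v) = (\<Sum>v\<in>K - {u}. 1)"
      by (rule sum.cong)
        (use clique u in \<open>auto simp: M_def degree_matrix_def adjacency_matrix_def\<close>)
    finally have "(M *v x) $ u = a * degree F u + (real (card K) - 1)" using card by simp
    moreover have "a * (real (card K) - 1) \<le> a * degree F u"
      using deg a by (rule mult_left_mono)
    ultimately show ?thesis by (simp add: algebra_simps)
  qed
  have "x \<bullet> (M *v x) = (\<Sum>u\<in>K. (M *v x) $ u)"
    using ind[of "\<lambda>u. (M *v x) $ u"] by (simp add: inner_vec_def)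
  also have "\<dots> \<ge> card K * ((a + 1) * (real (card K) - 1))"
    using row by (rule sum_bounded_below)
  finally have "card K * ((a + 1) * (real (card K) - 1)) \<le> largest_eigenvalue M * card K"
    using rayleigh xx by simp
  then show ?thesis using K by (simp add: M_def mult.commute)
qed

section \<open>Hall's theorem\<close>

text \<open>Induction on \<open>card I\<close>. If a proper nonempty \<open>J\<close> is tight,
  \<open>J\<close> is matched inside its own union \<open>B\<close> and the rest outside
  \<open>B\<close>. If no such \<open>J\<close> exists, any representative of one index may be fixed
  first.\<close>

lemma hall_marriage:
  fixes A :: "'i \<Rightarrow> 'b set"
  assumes "finite I" and "\<And>i. i \<in> I \<Longrightarrow> finite (A i)"
    and "\<And>J. J \<subseteq> I \<Longrightarrow> card J \<le> card (\<Union>(A ` J))"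
  shows "\<exists>s. inj_on s I \<and> (\<forall>i\<in>I. s i \<in> A i)"
  using assms
proof (induction "card I" arbitrary: I A rule: less_induct)
  case less
  note fin = less.prems(1,2) and hall = less.prems(3)
  show ?case
  proof (cases "I = {}")
    case False
    show ?thesis
    proof (cases "\<exists>J. J \<subset> I \<and> J \<noteq> {} \<and> card (\<Union>(A ` J)) = card J")
      case True
      then obtain J where J: "J \<subset> I" "J \<noteq> {}" "card (\<Union>(A ` J)) = card J" by blast
      define B where "B = \<Union>(A ` J)"
      have finJ: "finite J" using J fin(1) by (meson finite_subset psubset_imp_subset)
      have finB: "finite B" using J fin finJ by (auto simp: B_def)
      have "\<exists>s. inj_on s J \<and> (\<forall>i\<in>J. s i \<in> A i)"
        by (rule less.hyps) (use J fin finJ hall psubset_card_mono in auto)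
      then obtain s where s: "inj_on s J" "\<forall>i\<in>J. s i \<in> A i" by blast
      have "\<exists>s. inj_on s (I - J) \<and> (\<forall>i\<in>I - J. s i \<in> A i - B)"
      proof (rule less.hyps)
        show "card (I - J) < card I"
          using J fin(1) by (intro psubset_card_mono) auto
        fix L assume L: "L \<subseteq> I - J"
        have finL: "finite L" using L fin(1) finite_subset by blast
        have finL': "finite (\<Union>((\<lambda>i. A i - B) ` L))" using L finL fin(2) by auto
        \<comment> \<open>Hall's condition for \<open>L \<union> J\<close> gives that of
          \<open>L\<close> after removal of \<open>B\<close>, because \<open>B\<close> has exactly
          \<open>card J\<close> elements.\<close>
        have "card L + card J = card (L \<union> J)"
          using L finL finJ by (intro card_Un_disjoint[symmetric]) auto
        also have "\<dots> \<le> card (\<Union>(A ` (L \<union> J)))" using L J by (intro hall) auto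
        also have "\<Union>(A ` (L \<union> J)) = \<Union>((\<lambda>i. A i - B) ` L) \<union> B" by (auto simp: B_def)
        also have "card \<dots> = card (\<Union>((\<lambda>i. A i - B) ` L)) + card B"
          using finL' finB by (intro card_Un_disjoint) auto
        finally show "card L \<le> card (\<Union>((\<lambda>i. A i - B) ` L))" using J by (simp add: B_def)
      qed (use fin in auto)
      then obtain r where r: "inj_on r (I - J)" "\<forall>i\<in>I - J. r i \<in> A i - B" by blast
      have "inj_on (\<lambda>i. if i \<in> J then s i else r i) I"
        using s r unfolding inj_on_def B_def by (smt (verit) DiffD2 DiffI UN_I)
      then show ?thesis using s r by (intro exI[of _ "\<lambda>i. if i \<in> J then s i else r i"]) auto
    next
      case no_tight: False
      from False obtain i where i: "i \<in> I" by blast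
      have "card {i} \<le> card (\<Union>(A ` {i}))" using i by (intro hall) auto
      then obtain b where b: "b \<in> A i" by (cases "A i = {}") auto
      have "\<exists>s. inj_on s (I - {i}) \<and> (\<forall>j\<in>I - {i}. s j \<in> A j - {b})"
      proof (rule less.hyps)
        show "card (I - {i}) < card I" using i fin(1) by (rule card_Diff1_less[rotated])
        fix L assume L: "L \<subseteq> I - {i}"
        show "card L \<le> card (\<Union>((\<lambda>j. A j - {b}) ` L))"
        proof (cases "L = {}")
          case False
          have "L \<subset> I" using L i by auto
          \<comment> \<open>Hall's inequality is strict here, which leaves room for the loss of the
            single element \<open>b\<close>.\<close>
          then have "card L < card (\<Union>(A ` L))"
            using no_tight False hall[of L] by (metis le_neq_implies_less psubset_imp_subset)
          moreover have "card (\<Union>(A ` L)) - 1 \<le> card (\<Union>(A ` L) - {b})"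
            by (simp add: card_Diff_singleton_if)
          moreover have "card (\<Union>(A ` L) - {b}) = card (\<Union>((\<lambda>j. A j - {b}) ` L))"
            by (rule arg_cong[where f = card]) auto
          ultimately show ?thesis by linarith
        qed simp
      qed (use fin in auto)
      then obtain s where s: "inj_on s (I - {i})" "\<forall>j\<in>I - {i}. s j \<in> A j - {b}" by blast
      have "inj_on (s(i := b)) I"
        using s unfolding inj_on_def by (auto split: if_splits)
      then show ?thesis using s b by (intro exI[of _ "s(i := b)"]) auto
    qed
  qed simp
qed

section \<open>Fractional perfect matchings and independent sets\<close>

lemma fractional_perfect_matching_of_bij:
  fixes E :: "('v::finite) set set"
  assumes E: "simple_graph E" and s: "bij s" and edge: "\<And>v. {v, s v} \<in> E"
  shows "\<exists>f. fractional_perfect_matching E f"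
proof -
  \<comment> \<open>An edge whose endpoints are exchanged by \<open>s\<close> is counted twice and
    receives weight 1; every other edge \<open>{v, s v}\<close> receives 1/2.\<close>
  define f where "f e = real (card {v. {v, s v} = e}) / 2" for e
  \<comment> \<open>Double counting: each vertex \<open>v\<close> contributes 1/2 to the one edge
    \<open>{v, s v}\<close>. Both the vertex sums and the total weight are instances.\<close>
  have swap: "(\<Sum>e | e \<in> E \<and> P e. f e) = real (card {v. P {v, s v}}) / 2" for P
  proof -
    have "card {v. P {v, s v}} = card (\<Union>e\<in>{e \<in> E. P e}. {v. {v, s v} = e})"
      using edge by (intro arg_cong[where f = card]) auto
    also have "\<dots> = (\<Sum>e | e \<in> E \<and> P e. card {v. {v, s v} = e})"
      by (rule card_UN_disjoint) auto
    finally show ?thesis by (simp add: f_def sum_divide_distrib)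
  qed
  have le1: "(\<Sum>e | e \<in> E \<and> v \<in> e. f e) \<le> 1" for v
  proof -
    \<comment> \<open>Only \<open>v\<close> itself and its preimage under \<open>s\<close>
      contribute weight at \<open>v\<close>.\<close>
    have "{u. v \<in> {u, s u}} \<subseteq> {v, inv s v}"
      using s by (auto simp: bij_is_inj inv_f_f)
    then have "card {u. v \<in> {u, s u}} \<le> card {v, inv s v}" by (intro card_mono) auto
    also have "\<dots> \<le> 2" by (simp add: card_insert_if)
    finally show ?thesis unfolding swap by simp
  qed
  have f0: "0 \<le> f e" for e by (simp add: f_def)
  have "f e \<le> 1" if e: "e \<in> E" for e
  proof -
    obtain v where "v \<in> e" using E e by (fastforce simp: simple_graph_def card_2_iff)
    then have "f e \<le> (\<Sum>e | e \<in> E \<and> v \<in> e. f e)"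
      using e f0 by (intro member_le_sum) auto
    then show ?thesis using le1 order_trans by blast
  qed
  moreover have "(\<Sum>e\<in>E. f e) = real CARD('v) / 2" using swap[of "\<lambda>_. True"] by simp
  ultimately show ?thesis
    unfolding fractional_perfect_matching_def fractional_matching_def using f0 le1 by blast
qed

lemma fractional_perfect_matching_or_independent_set:
  fixes E :: "('v::finite) set set"
  assumes E: "simple_graph E"
  obtains f where "fractional_perfect_matching E f"
  | I where "\<And>u v. u \<in> I \<Longrightarrow> v \<in> I \<Longrightarrow> {u, v} \<notin> E"
      and "card {v. \<exists>u\<in>I. {u, v} \<in> E} < card I"
proof -
  define N where "N X = (\<Union>u\<in>X. {v. {u, v} \<in> E})" for X
  show ?thesis
  proof (cases "\<forall>X. card X \<le> card (N X)")
    case True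
    then have "\<exists>s. inj_on s UNIV \<and> (\<forall>u\<in>UNIV. s u \<in> {v. {u, v} \<in> E})"
      by (intro hall_marriage) (auto simp: N_def)
    then obtain s where "inj s" "\<And>u. {u, s u} \<in> E" by auto
    then show ?thesis
      using fractional_perfect_matching_of_bij[OF E] that(1)
      by (metis bij_def finite finite_UNIV_inj_surj)
  next
    case False
    then obtain X where X: "card (N X) < card X" by (auto simp: not_le)
    define I where "I = X - N X"
    have indep: "{u, v} \<notin> E" if "u \<in> I" "v \<in> I" for u v
      using that by (auto simp: I_def N_def)
    \<comment> \<open>Adjacency is symmetric, so a neighbour in \<open>X\<close> of a vertex of
      \<open>I\<close> would put that vertex into \<open>N X\<close>.\<close>
    have "{v. \<exists>u\<in>I. {u, v} \<in> E} \<subseteq> N X - X"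
      by (auto simp: I_def N_def insert_commute)
    then have "card {v. \<exists>u\<in>I. {u, v} \<in> E} \<le> card (N X - X)" by (intro card_mono) auto
    \<comment> \<open>Both \<open>N X - X\<close> and \<open>I\<close> arise by deleting
      \<open>X \<inter> N X\<close>, which preserves the strict inequality.\<close>
    also have "\<dots> < card I"
      using X by (simp add: I_def card_Diff_subset_Int Int_commute diff_less_mono card_mono)
    finally show ?thesis using that(2) indep by blast
  qed
qed

theorem corollary4p5:
  fixes a :: real and E :: "('v::finite) set set" and n :: nat
  assumes "a \<ge> 0"
    and "simple_graph E"
    and "connected_graph E"
    and "n = CARD('v)"
    and "real (min_degree E) \<le> (real n - 1) / 2"
    and "largest_eigenvalue (a *\<^sub>R degree_matrix (complement_graph E)
           + adjacency_matrix (complement_graph E))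
         < (a + 1) * real (min_degree E)"
  shows "\<exists>f. fractional_perfect_matching E f"
  using \<open>simple_graph E\<close>
proof (cases rule: fractional_perfect_matching_or_independent_set)
  case (2 I)
  let ?F = "complement_graph E"
  obtain u where u: "u \<in> I" using 2(2) by fastforce
  have "min_degree E \<le> degree E u" by (simp add: min_degree_def)
  also have "\<dots> \<le> card {v. \<exists>u\<in>I. {u, v} \<in> E}"
    unfolding degree_eq_card_neighbours[OF \<open>simple_graph E\<close>]
    using u by (intro card_mono) auto
  \<comment> \<open>The strict inequality between natural numbers supplies the \<open>- 1\<close>
    that matches the clique bound.\<close>
  finally have "real (min_degree E) \<le> real (card I) - 1" using 2(2) by linarith
  then have "(a + 1) * real (min_degree E) \<le> (a + 1) * (real (card I) - 1)"
    using \<open>a \<ge> 0\<close> by (intro mult_left_mono) auto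
  also have "\<dots> \<le> largest_eigenvalue (a *\<^sub>R degree_matrix ?F + adjacency_matrix ?F)"
  proof (rule clique_bound_largest_eigenvalue)
    show "simple_graph ?F" by (simp add: simple_graph_def complement_graph_def)
    show "{v, w} \<in> ?F" if "v \<in> I" "w \<in> I" "v \<noteq> w" for v w
      using that 2(1) by (simp add: complement_graph_def)
  qed (use u \<open>a \<ge> 0\<close> in auto)
  finally show ?thesis using assms(6) by linarith
qed blast

end
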